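(* Let $(X,X_+,\mathcal K,f)$ be an abstract state space, $P$ a projection on $X$, and $S,T\in\Sigma_P^{inv}(X)$. If $\delta_P(T^m)<1$ for some $m\in\mathbb N$, then for every $x,z\in\mathcal K$ with $x-z\in N_P$ and every $n\in\mathbb N$, $$\|T^nx-S^nz\|\le \delta_P(T^m)^{\lfloor n/m\rfloor}\Big(\|x-z\|+\max_{0<i<m}\|T^i-S^i\|\Big)+\frac{1-\delta_P(T^m)^{\lfloor n/m\rfloor}}{1-\delta_P(T^m)}\,\|T^m-S^m\|.$$
   Context: Let $X$ be a real ordered vector space with generating cone $X_+$ ($X=X_+-X_+$), let $f$ be a strictly positive linear functional on $X$ ($f(x)>0$ for $x>0$), and let $\mathcal K=\{x\in X_+: f(x)=1\}$. Let $U$ be the convex hull of $\mathcal K\cup(-\mathcal K)$ and $\|x\|=\inf\{t\ge 0: x\in tU\}$. $(X,X_+,\mathcal K,f)$ is an abstract state space if this seminorm is a norm, $X$ is complete for it, and $X_+$ is closed; $X$ always carries this norm. A linear operator $T:X\to X$ is Markov if it is positive and $T(\mathcal K)\subset\mathcal K$. A projection is a bounded linear operator $P$ with $P^2=P$; $N_P=\{x\in X: Px=0\}$. $\Sigma_P^{inv}(X)$ is the set of Markov operators $T$ on $X$ with $TP=PT=P$. For a bounded linear operator $T$, $\delta_P(T)=\sup\{\|Tx\|/\|x\| : x\in N_P,\ x\ne0\}$ if $P\ne I$, and $\delta_I(T)=1$ by convention. Conventions: $\mathbb N=\{1,2,\dots\}$, a maximum over an empty index set is $0$, and $0^0=1$.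 *)

theory Defs
  imports "HOL-Analysis.Analysis"
begin

text \<open>The order of the type class is that of the space, so the cone is
  \<open>{x. 0 \<le> x}\<close>, and \<open>f\<close> is the functional that determines the base.\<close>

definition cone_base :: "('a::ordered_real_vector \<Rightarrow> real) \<Rightarrow> 'a set" where
  "cone_base f = {x. 0 \<le> x \<and> f x = 1}"

definition base_unit :: "('a::ordered_real_vector \<Rightarrow> real) \<Rightarrow> 'a set" where
  "base_unit f = convex hull (cone_base f \<union> uminus ` cone_base f)"

definition base_norm :: "('a::ordered_real_vector \<Rightarrow> real) \<Rightarrow> 'a \<Rightarrow> real" where
  "base_norm f x = Inf {t. 0 \<le> t \<and> x \<in> (\<lambda>u. t *\<^sub>R u) ` base_unit f}"

text \<open>That the seminorm \<open>base_norm f\<close> is a norm, and that the space is complete for it,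
  is expressed by requiring it to be the norm of the class \<open>banach\<close>; all topological
  notions (closedness, bounded operators, operator norm) then refer to it.\<close>

definition abstract_state_space ::
    "('a::{banach,ordered_real_vector} \<Rightarrow> real) \<Rightarrow> bool" where
  "abstract_state_space f \<longleftrightarrow>
     (\<forall>x::'a. \<exists>y z. 0 \<le> y \<and> 0 \<le> z \<and> x = y - z) \<and>
     linear f \<and> (\<forall>x. 0 < x \<longrightarrow> 0 < f x) \<and>
     (\<forall>x. norm x = base_norm f x) \<and>
     closed {x::'a. 0 \<le> x}"

definition markov ::
    "('a::ordered_real_vector \<Rightarrow> real) \<Rightarrow> ('a \<Rightarrow> 'a) \<Rightarrow> bool" where
  "markov f T \<longleftrightarrow> linear T \<and> (\<forall>x\<ge>0. 0 \<le> T x) \<and> T ` cone_base f \<subseteq> cone_base f"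

definition projection :: "('a::real_normed_vector \<Rightarrow> 'a) \<Rightarrow> bool" where
  "projection P \<longleftrightarrow> bounded_linear P \<and> P \<circ> P = P"

definition null_space :: "('a::real_vector \<Rightarrow> 'a) \<Rightarrow> 'a set" where
  "null_space P = {x. P x = 0}"

definition Sigma_inv ::
    "('a::ordered_real_vector \<Rightarrow> real) \<Rightarrow> ('a \<Rightarrow> 'a) \<Rightarrow> ('a \<Rightarrow> 'a) set" where
  "Sigma_inv f P = {T. markov f T \<and> T \<circ> P = P \<and> P \<circ> T = P}"

text \<open>The generalized Dobrushin ergodicity coefficient. For a projection \<open>P \<noteq> id\<close> and a
  bounded linear \<open>T\<close> the supremum is over a nonempty bounded set.\<close>

definition dobrushin ::
    "('a::real_normed_vector \<Rightarrow> 'a) \<Rightarrow> ('a \<Rightarrow> 'a) \<Rightarrow> real" where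
  "dobrushin P T =
     (if P = id then 1 else Sup {norm (T x) / norm x |x. x \<in> null_space P \<and> x \<noteq> 0})"

text \<open>Maximum of a finite set of reals, with value \<open>0\<close> on the empty set
  (where \<open>Max\<close> is unspecified).\<close>

definition Max0 :: "real set \<Rightarrow> real" where
  "Max0 A = (if A = {} then 0 else Max A)"

end

theory Submission
  imports Defs
begin

text \<open>
  Because \<open>P \<circ> T = P = P \<circ> S\<close>, the trajectories of two points with \<open>P x = P z\<close> always
  differ by an element of the null space of \<open>P\<close>, where \<open>T ^^ m\<close> contracts by the factor
  \<open>\<delta> = dobrushin P (T ^^ m)\<close>.  Splitting \<open>(T ^^ (m + k)) x - (S ^^ (m + k)) z\<close> into
  \<open>(T ^^ m) ((T ^^ k) x - (S ^^ k) z)\<close> and \<open>(T ^^ m - S ^^ m) ((S ^^ k) z)\<close> therefore yields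
  the affine recursion \<open>a (m + k) \<le> \<delta> * a k + B\<close> for the distance \<open>a k\<close> of the two
  trajectories, where \<open>B\<close> is the operator norm of \<open>T ^^ m - S ^^ m\<close>; here \<open>S ^^ k\<close> keeps \<open>z\<close>
  in the base, whose points have norm at most one.  With \<open>n = q * m + r\<close> and \<open>r < m\<close>,
  iterating \<open>q\<close> times from \<open>a r\<close> sums a geometric series (\<open>affine_recursion_bound\<close>).  The
  same splitting with \<open>r\<close> and \<open>0\<close> in place of \<open>m\<close> and \<open>k\<close> bounds \<open>a r\<close>, now with factor
  one, since Markov operators do not increase the base norm.

  The latter fact (\<open>markov_contraction\<close>) also makes Markov operators bounded, so that the
  operator norms and the supremum in the Dobrushin coefficient are meaningful.
\<close>

text \<open>The infimum in the base norm is over a nonempty set because the cone is generating: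
  scale the two parts of a decomposition into the base and combine them convexly.  A zero
  part has no scaling of its own, so that an arbitrary base point is used for it.\<close>

lemma base_unit_absorbing:
  assumes "abstract_state_space f" and x: "x \<noteq> 0"
  shows "\<exists>t\<ge>0. x \<in> (\<lambda>u. t *\<^sub>R u) ` base_unit f"
proof -
  have lin: "linear f" and pos: "\<And>y. 0 < y \<Longrightarrow> 0 < f y"
    using assms by (auto simp: abstract_state_space_def)
  obtain y z where yz: "0 \<le> y" "0 \<le> z" "x = y - z"
    using assms unfolding abstract_state_space_def by metis
  have scaled: "(1 / f y) *\<^sub>R y \<in> cone_base f" if "0 < y" for y
    using pos[OF that] that
    by (auto simp: cone_base_def linear_scale[OF lin] intro!: scaleR_nonneg_nonneg)
  have "0 < y \<or> 0 < z"
    using yz x by (auto simp: less_le)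
  then obtain k where k: "k \<in> cone_base f"
    using scaled by blast
  have part: "\<exists>c\<in>cone_base f. y = f y *\<^sub>R c \<and> 0 \<le> f y \<and> (y \<noteq> 0 \<longrightarrow> 0 < f y)" if "0 \<le> y" for y
  proof (cases "y = 0")
    case True
    then show ?thesis using k by (auto simp: linear_0[OF lin])
  next
    case False
    then have "0 < y" using that by simp
    then show ?thesis using pos[of y] by (intro bexI[OF _ scaled]) auto
  qed
  obtain c where c: "c \<in> cone_base f" "y = f y *\<^sub>R c" "0 \<le> f y" "y \<noteq> 0 \<longrightarrow> 0 < f y"
    using part[OF yz(1)] by blast
  obtain d where d: "d \<in> cone_base f" "z = f z *\<^sub>R d" "0 \<le> f z" "z \<noteq> 0 \<longrightarrow> 0 < f z"
    using part[OF yz(2)] by blast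
  define t where "t = f y + f z"
  have t: "0 < t"
    using c d yz(3) x unfolding t_def by (cases "y = 0"; cases "z = 0") auto
  define u where "u = (f y / t) *\<^sub>R c + (f z / t) *\<^sub>R (- d)"
  have "u \<in> base_unit f"
    unfolding u_def base_unit_def
    using c d t
    by (intro convexD[OF convex_convex_hull] hull_inc)
       (auto simp: t_def add_divide_distrib[symmetric])
  moreover have "t *\<^sub>R u = f y *\<^sub>R c - f z *\<^sub>R d"
    using t by (simp add: u_def scaleR_diff_right)
  then have "x = t *\<^sub>R u"
    using c(2) d(2) yz(3) by simp
  ultimately show ?thesis
    using t by (intro exI[of _ t]) auto
qed

text \<open>A Markov operator maps the base, hence the unit body spanned by it, into itself.\<close>

lemma markov_contraction:
  assumes X: "abstract_state_space f" and T: "markov f T"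
  shows "norm (T x) \<le> norm x"
proof (cases "x = 0")
  case True
  then show ?thesis using T by (simp add: markov_def linear_0)
next
  case False
  have lin: "linear T" and base: "T ` cone_base f \<subseteq> cone_base f"
    using T by (auto simp: markov_def)
  have "T ` base_unit f = convex hull (T ` (cone_base f \<union> uminus ` cone_base f))"
    unfolding base_unit_def using lin by (rule convex_hull_linear_image)
  also have "\<dots> \<subseteq> base_unit f"
    unfolding base_unit_def using base
    by (intro hull_mono) (auto simp: linear_neg[OF lin])
  finally have unit: "T ` base_unit f \<subseteq> base_unit f" .
  have "{t. 0 \<le> t \<and> x \<in> (\<lambda>u. t *\<^sub>R u) ` base_unit f}
      \<subseteq> {t. 0 \<le> t \<and> T x \<in> (\<lambda>u. t *\<^sub>R u) ` base_unit f}"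
    using unit by (auto simp: linear_scale[OF lin] intro!: imageI)
  then have "base_norm f (T x) \<le> base_norm f x"
    unfolding base_norm_def using base_unit_absorbing[OF X False]
    by (intro cInf_superset_mono) (auto intro: bdd_belowI[of _ 0])
  then show ?thesis using X by (simp add: abstract_state_space_def)
qed

lemma markov_bounded_linear:
  assumes "abstract_state_space f" and "markov f T"
  shows "bounded_linear T"
  using assms markov_contraction[OF assms]
  by (intro bounded_linear_intro[where K = 1])
     (auto simp: markov_def linear_add linear_scale)

lemma norm_cone_base_le_1:
  assumes "abstract_state_space f" and "z \<in> cone_base f"
  shows "norm z \<le> 1"
proof -
  have "z \<in> base_unit f"
    using assms(2) by (auto simp: base_unit_def intro: hull_inc)
  then have "base_norm f z \<le> 1"
    unfolding base_norm_def by (intro cInf_lower) (auto intro: bdd_belowI[of _ 0])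
  then show ?thesis using assms(1) by (simp add: abstract_state_space_def)
qed

lemma Sigma_inv_funpow:
  assumes "T \<in> Sigma_inv f P"
  shows "T ^^ n \<in> Sigma_inv f P"
proof (induction n)
  case 0
  then show ?case
    by (simp add: Sigma_inv_def markov_def linear_id[unfolded id_def] id_def comp_def)
next
  case (Suc n)
  have "linear (T \<circ> T ^^ n)"
    using assms Suc by (auto simp: Sigma_inv_def markov_def intro: linear_compose)
  then show ?case
    using assms Suc by (auto simp: Sigma_inv_def markov_def fun_eq_iff image_subset_iff comp_def)
qed

text \<open>For \<open>P \<noteq> id\<close> the null space contains some \<open>x - P x \<noteq> 0\<close>, so that the supremum is a
  genuine one; its nonnegativity and its defining estimate rest on this.\<close>

lemma
  assumes "projection P" and "P \<noteq> id" and "bounded_linear T"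
  shows dobrushin_nonneg: "0 \<le> dobrushin P T"
    and norm_le_dobrushin: "x \<in> null_space P \<Longrightarrow> norm (T x) \<le> dobrushin P T * norm x"
proof -
  let ?R = "{norm (T x) / norm x |x. x \<in> null_space P \<and> x \<noteq> 0}"
  have eq: "dobrushin P T = Sup ?R"
    using assms(2) by (simp add: dobrushin_def)
  have bdd: "bdd_above ?R"
    using le_onorm[OF assms(3)] by (auto intro: bdd_aboveI[of _ "onorm T"])
  obtain v where v: "P v \<noteq> v"
    using assms(2) by fastforce
  have "P (v - P v) = 0"
    using assms(1) by (simp add: projection_def linear_diff[OF bounded_linear.linear] fun_eq_iff)
  with v have "norm (T (v - P v)) / norm (v - P v) \<in> ?R"
    by (auto simp: null_space_def)
  from cSup_upper[OF this bdd] show "0 \<le> dobrushin P T"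
    unfolding eq by (rule order_trans[rotated]) simp
  show "norm (T x) \<le> dobrushin P T * norm x" if "x \<in> null_space P"
  proof (cases "x = 0")
    case True
    then show ?thesis using assms(3) by (simp add: bounded_linear.linear linear_0)
  next
    case False
    with that have "norm (T x) / norm x \<le> dobrushin P T"
      unfolding eq by (intro cSup_upper bdd) auto
    with False show ?thesis by (simp add: divide_le_eq)
  qed
qed

lemma affine_recursion_bound:
  fixes a :: "nat \<Rightarrow> real"
  assumes "0 \<le> d" and "d < 1" and "\<And>k. a (Suc k) \<le> d * a k + B"
  shows "a q \<le> d ^ q * a 0 + (1 - d ^ q) / (1 - d) * B"
proof (induction q)
  case 0
  then show ?case by simp
next
  case (Suc q)
  have "a (Suc q) \<le> d * (d ^ q * a 0 + (1 - d ^ q) / (1 - d) * B) + B"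
    using assms(3)[of q] mult_left_mono[OF Suc assms(1)] by linarith
  also have "\<dots> = d ^ Suc q * a 0 + (1 - d ^ Suc q) / (1 - d) * B"
    using assms(2) by (simp add: field_simps)
  finally show ?case .
qed

theorem theorem7p3:
  fixes f :: "'a::{banach,ordered_real_vector} \<Rightarrow> real"
    and P S T :: "'a \<Rightarrow> 'a"
    and m :: nat
  assumes "abstract_state_space f"
    and "projection P"
    and "S \<in> Sigma_inv f P" and "T \<in> Sigma_inv f P"
    and "1 \<le> m" and "dobrushin P (T ^^ m) < 1"
  shows "\<forall>x\<in>cone_base f. \<forall>z\<in>cone_base f. \<forall>n::nat. x - z \<in> null_space P \<longrightarrow> 1 \<le> n \<longrightarrow>
    norm ((T ^^ n) x - (S ^^ n) z) \<le>
      dobrushin P (T ^^ m) ^ (n div m) *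
        (norm (x - z) + Max0 ((\<lambda>i. onorm (\<lambda>y. (T ^^ i) y - (S ^^ i) y)) ` {0<..<m}))
      + (1 - dobrushin P (T ^^ m) ^ (n div m)) / (1 - dobrushin P (T ^^ m)) *
        onorm (\<lambda>y. (T ^^ m) y - (S ^^ m) y)"
proof (intro ballI allI impI)
  fix x z n
  assume x: "x \<in> cone_base f" and z: "z \<in> cone_base f" and xz: "x - z \<in> null_space P"
  let ?D = "\<lambda>i y. (T ^^ i) y - (S ^^ i) y"
  let ?a = "\<lambda>i. norm ((T ^^ i) x - (S ^^ i) z)"
  let ?M = "Max0 ((\<lambda>i. onorm (?D i)) ` {0<..<m})"
  define d where "d = dobrushin P (T ^^ m)"
  note X = assms(1)
  have Tm: "markov f (T ^^ i)" and Sm: "markov f (S ^^ i)"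
    and PT: "P \<circ> T ^^ i = P" and PS: "P \<circ> S ^^ i = P" for i
    using Sigma_inv_funpow[OF assms(4), of i] Sigma_inv_funpow[OF assms(3), of i]
    by (auto simp: Sigma_inv_def)
  note Tb = markov_bounded_linear[OF X Tm]
  have Db: "bounded_linear (?D i)" for i
    using Tb[of i] markov_bounded_linear[OF X Sm[of i]] by (rule bounded_linear_sub)
  have T_diff: "(T ^^ i) (u - v) = (T ^^ i) u - (T ^^ i) v" for i u v
    using Tb by (intro linear_diff bounded_linear.linear)
  have P_diff: "P (u - v) = P u - P v" for u v
    using assms(2) unfolding projection_def by (intro linear_diff bounded_linear.linear) auto
  \<comment> \<open>By convention the coefficient is one for the identity.\<close>
  have P: "P \<noteq> id"
    using assms(6) by (auto simp: dobrushin_def)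
  have null: "(T ^^ i) x - (S ^^ i) z \<in> null_space P" for i
    using xz fun_cong[OF PT[of i], of x] fun_cong[OF PS[of i], of z]
    by (simp add: null_space_def P_diff)
  have drift: "norm (?D i ((S ^^ k) z)) \<le> onorm (?D i)" for i k
  proof -
    have "(S ^^ k) z \<in> cone_base f"
      using Sm[of k] z by (auto simp: markov_def)
    then have "onorm (?D i) * norm ((S ^^ k) z) \<le> onorm (?D i) * 1"
      by (intro mult_left_mono norm_cone_base_le_1[OF X] onorm_pos_le[OF Db])
    then show ?thesis using onorm[OF Db[of i], of "(S ^^ k) z"] by linarith
  qed
  have split: "(T ^^ (i + k)) x - (S ^^ (i + k)) z
      = (T ^^ i) ((T ^^ k) x - (S ^^ k) z) + ?D i ((S ^^ k) z)" for i k
    by (simp add: funpow_add T_diff)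
  have step: "?a (m + k) \<le> d * ?a k + onorm (?D m)" for k
    using norm_triangle_mono[OF norm_le_dobrushin[OF assms(2) P Tb[of m] null[of k]]
        drift[of m k]]
    by (simp only: split d_def)
  \<comment> \<open>The residue \<open>0\<close> is not among the indices of the maximum, but its term vanishes.\<close>
  have start: "?a (n mod m) \<le> norm (x - z) + ?M"
  proof -
    have "onorm (?D (n mod m)) \<le> ?M"
    proof (cases "n mod m = 0")
      case True
      have "0 \<le> ?M"
      proof (cases "{0<..<m} = {}")
        case True
        then show ?thesis by (simp add: Max0_def)
      next
        case False
        then show ?thesis
          using onorm_pos_le[OF Db] by (auto simp: Max0_def Max_ge_iff simp del: image_is_empty)
      qed
      with True show ?thesis by (simp add: onorm_zero)
    next
      case False
      then have "n mod m \<in> {0<..<m}"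
        using assms(5) by simp
      then have "{0<..<m} \<noteq> {}" and "onorm (?D (n mod m)) \<in> (\<lambda>i. onorm (?D i)) ` {0<..<m}"
        by blast+
      then show ?thesis by (simp only: Max0_def image_is_empty if_False) (simp add: Max_ge)
    qed
    then have "norm (?D (n mod m) z) \<le> ?M"
      using drift[of "n mod m" 0] by simp
    from norm_triangle_mono[OF markov_contraction[OF X Tm[of "n mod m"], of "x - z"] this]
    show ?thesis by (simp add: T_diff)
  qed
  have d: "0 \<le> d" "d < 1"
    using dobrushin_nonneg[OF assms(2) P Tb] assms(6) by (auto simp: d_def)
  have "?a n = ?a (n div m * m + n mod m)"
    by simp
  also have "\<dots> \<le> d ^ (n div m) * ?a (0 * m + n mod m)
      + (1 - d ^ (n div m)) / (1 - d) * onorm (?D m)"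
    by (rule affine_recursion_bound[OF d, where a = "\<lambda>q. ?a (q * m + n mod m)"])
       (use step in \<open>simp add: add.assoc\<close>)
  also have "\<dots> \<le> d ^ (n div m) * (norm (x - z) + ?M)
      + (1 - d ^ (n div m)) / (1 - d) * onorm (?D m)"
    using start d by (intro add_right_mono mult_left_mono) auto
  finally show "?a n \<le> dobrushin P (T ^^ m) ^ (n div m) * (norm (x - z) + ?M)
      + (1 - dobrushin P (T ^^ m) ^ (n div m)) / (1 - dobrushin P (T ^^ m)) * onorm (?D m)"
    by (simp only: d_def)
qed

end
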